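(* The Dowling polynomials $D_m(n,x)=\sum_{k=0}^n W_m(n,k)x^k$, $n\ge 0$, form the moments for a family of orthogonal polynomials.
   Context: The Whitney numbers of the second kind of Dowling lattices $W_m(n,k)$ are defined by $\sum_{n\ge 0} W_m(n,k)\frac{z^n}{n!}=\frac{e^z}{m^k k!}(e^{mz}-1)^k$; explicitly $W_m(n,k)=\sum_{i=k}^n\binom{n}{i}m^{i-k}S(i,k)$, where $S(i,k)$ are the Stirling numbers of the second kind. When $m=0$ one has $W_0(n,k)=\binom{n}{k}$. Here $m$ is a parameter and $x$ is the variable of the Dowling polynomials; $x$ acts as a parameter for the family of orthogonal polynomials, whose own variable is denoted $z$. Families of orthogonal polynomials and their moments are understood as follows. A family of orthogonal polynomials $(P_n(z))_{n\ge 0}$ is given by a three-term recurrence $P_n(z)=(z-(\alpha+(n-1)\gamma))P_{n-1}(z)-((n-1)\beta+(n-1)(n-2)\delta)P_{n-2}(z)$ with $P_0(z)=1$, $P_1(z)=z-\alpha$, where the coefficients $\alpha,\beta,\gamma,\delta$ do not depend on $n$ or $z$ (they may depend on $m$ and $x$). Its coefficient array is the lower-triangular matrix $(m^*_{n,k})$ with $P_n(z)=\sum_{k=0}^n m^*_{n,k}z^k$, and its moments are the elements of the first column of the inverse matrix $M=(m^*_{n,k})^{-1}$. *)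

theory Defs
  imports "HOL-Computational_Algebra.Polynomial"
    "HOL-Computational_Algebra.Formal_Power_Series"
    "HOL-Combinatorics.Stirling"
begin

(* The exponential generating function divides by m ^ k, so it determines the numbers only for
   nonzero m; for m = 0 the convention W_0(n,k) = (n choose k) is built in. *)
definition dowling_whitney :: "'a::field_char_0 \<Rightarrow> nat \<Rightarrow> nat \<Rightarrow> 'a" where
  "dowling_whitney m n k =
     (if m = 0 then of_nat (n choose k)
      else fact n * fps_nth (fps_const (1 / (m ^ k * fact k)) * fps_exp 1 * (fps_exp m - 1) ^ k) n)"

definition dowling_poly :: "'a::field_char_0 \<Rightarrow> nat \<Rightarrow> 'a poly" where
  "dowling_poly m n = (\<Sum>k\<le>n. monom (dowling_whitney m n k) k)"

(* In the third equation the index is Suc (Suc n), so Suc n is "index minus 1" and n is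
   "index minus 2". *)
fun orth_poly :: "'a::comm_ring_1 \<Rightarrow> 'a \<Rightarrow> 'a \<Rightarrow> 'a \<Rightarrow> nat \<Rightarrow> 'a poly" where
  "orth_poly \<alpha> \<beta> \<gamma> \<delta> 0 = 1"
| "orth_poly \<alpha> \<beta> \<gamma> \<delta> (Suc 0) = [:- \<alpha>, 1:]"
| "orth_poly \<alpha> \<beta> \<gamma> \<delta> (Suc (Suc n)) =
     [:- (\<alpha> + of_nat (Suc n) * \<gamma>), 1:] * orth_poly \<alpha> \<beta> \<gamma> \<delta> (Suc n)
     - smult (of_nat (Suc n) * \<beta> + of_nat (Suc n) * of_nat n * \<delta>) (orth_poly \<alpha> \<beta> \<gamma> \<delta> n)"

definition coeff_array :: "(nat \<Rightarrow> 'a::comm_ring_1 poly) \<Rightarrow> nat \<Rightarrow> nat \<Rightarrow> 'a" where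
  "coeff_array P n k = coeff (P n) k"

definition lower_triangular :: "(nat \<Rightarrow> nat \<Rightarrow> 'a::zero) \<Rightarrow> bool" where
  "lower_triangular A \<longleftrightarrow> (\<forall>n k. n < k \<longrightarrow> A n k = 0)"

(* Product of infinite matrices; since the left factor is lower triangular, the entries
   A n j with j > n vanish and the sum over j is finite. *)
definition lt_mult :: "(nat \<Rightarrow> nat \<Rightarrow> 'a::comm_ring_1) \<Rightarrow> (nat \<Rightarrow> nat \<Rightarrow> 'a) \<Rightarrow> nat \<Rightarrow> nat \<Rightarrow> 'a" where
  "lt_mult A B n k = (\<Sum>j\<le>n. A n j * B j k)"

definition id_array :: "nat \<Rightarrow> nat \<Rightarrow> 'a::comm_ring_1" where
  "id_array n k = (if n = k then 1 else 0)"

definition lt_inverse :: "(nat \<Rightarrow> nat \<Rightarrow> 'a::comm_ring_1) \<Rightarrow> (nat \<Rightarrow> nat \<Rightarrow> 'a) \<Rightarrow> bool" where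
  "lt_inverse A M \<longleftrightarrow>
     lower_triangular A \<and> lower_triangular M \<and> lt_mult A M = id_array \<and> lt_mult M A = id_array"

definition moments_of :: "(nat \<Rightarrow> 'a::comm_ring_1 poly) \<Rightarrow> (nat \<Rightarrow> 'a) \<Rightarrow> bool" where
  "moments_of P \<mu> \<longleftrightarrow> (\<exists>M. lt_inverse (coeff_array P) M \<and> (\<forall>n. \<mu> n = M n 0))"

lemma stirling_egf:
  fixes m :: "'a::field_char_0"
  shows "fact n * fps_nth (fps_const (1 / fact k) * (fps_exp m - 1) ^ k) n
    = m ^ n * of_nat (Stirling n k)"
proof (induction n arbitrary: k)
  case 0
  then show ?case by (cases k) auto
next
  case (Suc n)
  define S where "S k = fps_const (1 / fact k) * (fps_exp m - 1) ^ k" for k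
  show ?case
  proof (cases k)
    case 0
    then show ?thesis by simp
  next
    case k: (Suc j)
    have "fps_deriv ((fps_exp m - 1) ^ Suc j)
        = fps_const (of_nat (Suc j)) * (fps_const m * fps_exp m) * (fps_exp m - 1) ^ j"
      by (simp add: fps_deriv_power del: of_nat_Suc power_Suc)
    then have "fps_deriv (S (Suc j))
        = fps_const (1 / fact (Suc j)) * (fps_const (of_nat (Suc j)) * fps_const m * fps_exp m
            * (fps_exp m - 1) ^ j)"
      unfolding S_def by (simp only: fps_deriv_mult_const_left mult.assoc)
    also have "\<dots> = fps_const (1 / fact (Suc j)) * fps_const (of_nat (Suc j)) * fps_const m
         * ((fps_exp m - 1) ^ Suc j + (fps_exp m - 1) ^ j)"
      by (simp add: algebra_simps del: fact_Suc of_nat_Suc)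
    also have "\<dots> = fps_const (m * of_nat (Suc j)) * S (Suc j) + fps_const m *
         (fps_const (1 / fact (Suc j)) * fps_const (of_nat (Suc j)) * (fps_exp m - 1) ^ j)"
      unfolding S_def by (simp only: fps_const_mult[symmetric] ring_distribs ac_simps)
    also have "fps_const (1 / fact (Suc j)) * fps_const (of_nat (Suc j)) = fps_const (1 / fact j :: 'a)"
      by (simp add: fact_Suc del: of_nat_Suc)
    finally have d: "fps_deriv (S (Suc j)) = fps_const (m * of_nat (Suc j)) * S (Suc j) + fps_const m * S j"
      unfolding S_def .
    have "of_nat (Suc n) * fps_nth (S (Suc j)) (Suc n)
        = m * of_nat (Suc j) * fps_nth (S (Suc j)) n + m * fps_nth (S j) n"
      using arg_cong[OF d, of "\<lambda>f. fps_nth f n"] by simp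
    then have "fact n * (of_nat (Suc n) * fps_nth (S (Suc j)) (Suc n))
        = fact n * (m * of_nat (Suc j) * fps_nth (S (Suc j)) n + m * fps_nth (S j) n)"
      by (simp only:)
    then have "fact (Suc n) * fps_nth (S (Suc j)) (Suc n)
        = m * of_nat (Suc j) * (fact n * fps_nth (S (Suc j)) n) + m * (fact n * fps_nth (S j) n)"
      by (simp only: fact_Suc of_nat_mult ring_distribs ac_simps)
    also have "\<dots> = m ^ Suc n * of_nat (Stirling (Suc n) (Suc j))"
      using Suc.IH[of "Suc j"] Suc.IH[of j] unfolding S_def[symmetric]
      by (simp add: algebra_simps)
    finally show ?thesis unfolding S_def k .
  qed
qed

lemma dowling_whitney_explicit:
  fixes m :: "'a::field_char_0"
  shows "dowling_whitney m n k = (\<Sum>i=k..n. of_nat (n choose i) * m ^ (i - k) * of_nat (Stirling i k))"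
proof (cases "m = 0")
  case True
  have "(\<Sum>i=k..n. of_nat (n choose i) * m ^ (i - k) * of_nat (Stirling i k))
      = (\<Sum>i=k..n. if i = k then of_nat (n choose k) else (0::'a))"
    using True by (intro sum.cong) auto
  then show ?thesis using True by (simp add: dowling_whitney_def)
next
  case False
  define S where "S = fps_const (1 / fact k) * (fps_exp m - 1) ^ k"
  have c: "fps_const (1 / (m ^ k * fact k)) = fps_const (1 / m ^ k) * fps_const (1 / fact k)"
    by simp
  have "dowling_whitney m n k = fact n * fps_nth (fps_const (1 / m ^ k) * (S * fps_exp 1)) n"
    using False unfolding dowling_whitney_def S_def c by (simp only: if_False ac_simps)
  also have "\<dots> = fact n * (1 / m ^ k * (\<Sum>i=0..n. fps_nth S i * (1 / fact (n - i))))"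
    by (simp add: fps_mult_nth[of S])
  also have "\<dots> = (\<Sum>i=0..n. of_nat (n choose i) * (fact i * fps_nth S i) / m ^ k)"
    unfolding sum_distrib_left
    by (intro sum.cong) (auto simp: binomial_fact field_simps)
  also have "\<dots> = (\<Sum>i=0..n. of_nat (n choose i) * (m ^ i * of_nat (Stirling i k)) / m ^ k)"
    by (simp only: S_def stirling_egf)
  also have "\<dots> = (\<Sum>i=k..n. of_nat (n choose i) * (m ^ i * of_nat (Stirling i k)) / m ^ k)"
    by (intro sum.mono_neutral_right) auto
  also have "\<dots> = (\<Sum>i=k..n. of_nat (n choose i) * m ^ (i - k) * of_nat (Stirling i k))"
    using False by (intro sum.cong) (auto simp: power_diff)
  finally show ?thesis .
qed

end

theory Submission
  imports Defs
begin

text \<open>Let \<open>Q\<^sub>n(y) = D\<^sub>m(n, x + y)\<close>. The recurrence of the Whitney numbers says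
  \<open>Q\<^sub>n\<^sub>+\<^sub>1 = T Q\<^sub>n\<close> for the operator \<open>T f = (1 + x + y) f + m (x + y) f'\<close>, and
  \<open>T y\<^sup>k = y\<^sup>k\<^sup>+\<^sup>1 + (1 + x + k m) y\<^sup>k + k m x y\<^sup>k\<^sup>-\<^sup>1\<close>.
  Hence \<open>T\<close> acts on the powers of \<open>y\<close> as multiplication by \<open>z\<close> acts on the orthogonal
  polynomials with \<open>\<alpha> = 1 + x\<close>, \<open>\<beta> = m x\<close>, \<open>\<gamma> = m\<close>, \<open>\<delta> = 0\<close>. The linear maps \<open>z\<^sup>n \<mapsto> Q\<^sub>n\<close> and
  \<open>y\<^sup>n \<mapsto> P\<^sub>n\<close> are therefore mutually inverse, so the coefficients of the \<open>Q\<^sub>n\<close> form the inverse array,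
  whose first column is \<open>Q\<^sub>n(0) = D\<^sub>m(n, x)\<close>.\<close>

section \<open>Recurrences for the Whitney numbers and the Dowling polynomials\<close>

lemma dowling_whitney_eq_0: "n < k \<Longrightarrow> dowling_whitney m n k = 0"
  by (simp add: dowling_whitney_explicit)

lemma dowling_whitney_0: "dowling_whitney m 0 k = (if k = 0 then 1 else 0)"
  by (cases k) (simp_all add: dowling_whitney_explicit)

text \<open>For \<open>m = 0\<close> this is Pascal's rule. Otherwise the generating functions
  satisfy \<open>F_k' = (1 + k m) F_k + F_(k-1)\<close>, and coefficients are compared.\<close>

lemma dowling_whitney_Suc:
  fixes m :: "'a::field_char_0"
  shows "dowling_whitney m (Suc n) k =
    (1 + of_nat k * m) * dowling_whitney m n k + (if k = 0 then 0 else dowling_whitney m n (k - 1))"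
proof (cases "m = 0")
  case True
  then show ?thesis
    by (cases k) (simp_all add: dowling_whitney_def)
next
  case False
  define F where "F k = fps_const (1 / (m ^ k * fact k)) * fps_exp 1 * (fps_exp m - 1) ^ k" for k
  have W: "dowling_whitney m n k = fact n * fps_nth (F k) n" for n k
    using False by (simp add: dowling_whitney_def F_def)
  have F_deriv: "fps_deriv (F k) =
      fps_const (1 + of_nat k * m) * F k + (if k = 0 then 0 else F (k - 1))"
  proof (cases k)
    case 0
    then show ?thesis by (simp add: F_def)
  next
    case (Suc j)
    define c where "c k = 1 / (m ^ k * fact k)" for k
    define E where "E = fps_exp m - 1"
    \<comment> \<open>The factor \<open>(j + 1) m\<close> from the chain rule turns the
      normalisation of \<open>F (Suc j)\<close> into that of \<open>F j\<close>.\<close>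
    have c: "c (Suc j) * (of_nat (Suc j) * m) = c j"
      using False by (simp add: c_def field_simps del: of_nat_Suc)
    \<comment> \<open>Writing the exponential as \<open>E + 1\<close> keeps the derivative inside
      the powers of \<open>E\<close>.\<close>
    have E': "fps_deriv (E ^ Suc j) = fps_const (of_nat (Suc j) * m) * (E ^ Suc j + E ^ j)"
    proof -
      have "fps_deriv E = fps_const m * (E + 1)"
        by (simp add: E_def)
      then have "fps_deriv (E ^ Suc j) =
          fps_const (of_nat (Suc j)) * (fps_const m * (E + 1)) * E ^ j"
        by (simp add: fps_deriv_power del: of_nat_Suc power_Suc)
      then show ?thesis
        by (simp add: algebra_simps del: of_nat_Suc fps_const_mult flip: fps_const_mult)
    qed
    have "fps_deriv (F (Suc j)) = fps_const (c (Suc j)) *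
        (fps_exp 1 * E ^ Suc j
          + fps_exp 1 * (fps_const (of_nat (Suc j) * m) * (E ^ Suc j + E ^ j)))"
      unfolding F_def c_def[symmetric] E_def[symmetric] mult.assoc
        fps_deriv_mult_const_left fps_deriv_mult E'
      by (simp add: algebra_simps del: of_nat_Suc power_Suc fps_const_mult)
    also have "\<dots> = (1 + fps_const (of_nat (Suc j) * m)) * F (Suc j)
        + fps_const (c (Suc j) * (of_nat (Suc j) * m)) * fps_exp 1 * E ^ j"
      unfolding F_def c_def[symmetric] E_def[symmetric] fps_const_mult[symmetric]
      by (simp add: algebra_simps del: of_nat_Suc power_Suc fps_const_mult)
    also have "\<dots> = fps_const (1 + of_nat (Suc j) * m) * F (Suc j) + F j"
      unfolding c unfolding F_def c_def[symmetric] E_def[symmetric]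
      by (simp add: algebra_simps del: of_nat_Suc power_Suc fps_const_mult flip: fps_const_add)
    finally show ?thesis
      by (simp add: Suc)
  qed
  have "dowling_whitney m (Suc n) k = fact n * fps_nth (fps_deriv (F k)) n"
    by (simp add: W algebra_simps)
  then show ?thesis
    by (simp add: F_deriv W algebra_simps)
qed

lemma coeff_dowling_poly: "coeff (dowling_poly m n) k = dowling_whitney m n k"
proof -
  have "coeff (dowling_poly m n) k = (\<Sum>j\<le>n. if j = k then dowling_whitney m n j else 0)"
    by (simp add: dowling_poly_def coeff_sum)
  also have "\<dots> = dowling_whitney m n k"
    by (simp add: dowling_whitney_eq_0)
  finally show ?thesis .
qed

lemma degree_dowling_poly_le: "degree (dowling_poly m n) \<le> n"
  by (rule degree_le) (simp add: coeff_dowling_poly dowling_whitney_eq_0)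

lemma dowling_poly_0: "dowling_poly m 0 = 1"
  by (simp add: dowling_poly_def dowling_whitney_0)

text \<open>In the Whitney recurrence, the factor \<open>k\<close> becomes the operator
  \<open>x d/dx\<close> and the shift of \<open>k\<close> becomes multiplication by
  \<open>x\<close>.\<close>

lemma dowling_poly_Suc:
  "dowling_poly m (Suc n) =
    [:1, 1:] * dowling_poly m n + smult m ([:0, 1:] * pderiv (dowling_poly m n))"
proof (rule poly_eqI)
  fix k
  show "coeff (dowling_poly m (Suc n)) k = coeff
      ([:1, 1:] * dowling_poly m n + smult m ([:0, 1:] * pderiv (dowling_poly m n))) k"
    by (cases k) (simp_all add: coeff_dowling_poly dowling_whitney_Suc coeff_pderiv algebra_simps)
qed

section \<open>The shifted polynomials \<open>Q_n\<close> and the operator \<open>T\<close>\<close>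

definition shifted_dowling :: "'a::field_char_0 \<Rightarrow> 'a \<Rightarrow> nat \<Rightarrow> 'a poly" where
  "shifted_dowling m x n = pcompose (dowling_poly m n) [:x, 1:]"

definition dowling_op :: "'a::field_char_0 \<Rightarrow> 'a \<Rightarrow> 'a poly \<Rightarrow> 'a poly" where
  "dowling_op m x f = [:1 + x, 1:] * f + smult m ([:x, 1:] * pderiv f)"

lemma shifted_dowling_0: "shifted_dowling m x 0 = 1"
  by (simp add: shifted_dowling_def dowling_poly_0 pcompose_const one_pCons)

lemma shifted_dowling_Suc:
  "shifted_dowling m x (Suc n) = dowling_op m x (shifted_dowling m x n)"
  by (simp add: shifted_dowling_def dowling_op_def dowling_poly_Suc pcompose_add pcompose_mult
      pcompose_smult pcompose_pCons pderiv_pcompose pderiv_pCons algebra_simps smult_add_left)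

lemma degree_shifted_dowling_le: "degree (shifted_dowling m x n) \<le> n"
  by (simp add: shifted_dowling_def degree_dowling_poly_le degree_pcompose)

lemma coeff_shifted_dowling_0: "coeff (shifted_dowling m x n) 0 = poly (dowling_poly m n) x"
  by (simp add: shifted_dowling_def poly_pcompose flip: poly_0_coeff_0)

lemma dowling_op_add: "dowling_op m x (f + g) = dowling_op m x f + dowling_op m x g"
  by (simp add: dowling_op_def pderiv_add algebra_simps smult_add_right)

lemma dowling_op_smult: "dowling_op m x (smult c f) = smult c (dowling_op m x f)"
  by (simp add: dowling_op_def pderiv_smult algebra_simps smult_add_right)

text \<open>These coefficients dictate the parameters of the orthogonal family. At
  \<open>k = 0\<close> the factor \<open>of_nat k\<close> removes the term with the truncated
  \<open>k - 1\<close>.\<close>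

lemma dowling_op_monom:
  "dowling_op m x (monom 1 k) = monom 1 (Suc k) + smult (1 + x + of_nat k * m) (monom 1 k)
    + smult (of_nat k * (m * x)) (monom 1 (k - 1))"
  by (cases k; rule poly_eqI)
    (auto simp: dowling_op_def pderiv_monom coeff_pCons algebra_simps split: nat.splits)

section \<open>Degree bound and uniform recurrence for the orthogonal polynomials\<close>

lemma degree_orth_poly_le: "degree (orth_poly \<alpha> \<beta> \<gamma> \<delta> n) \<le> n"
proof (induction \<alpha> \<beta> \<gamma> \<delta> n rule: orth_poly.induct)
  case (3 \<alpha> \<beta> \<gamma> \<delta> n)
  have "degree ([:- (\<alpha> + of_nat (Suc n) * \<gamma>), 1:] * orth_poly \<alpha> \<beta> \<gamma> \<delta> (Suc n)) \<le> 1 + Suc n"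
    using 3(1) by (intro order_trans[OF degree_mult_le add_mono]) simp_all
  with 3(2) show ?case
    unfolding orth_poly.simps
    by (intro degree_diff_le order_trans[OF degree_smult_le]) auto
qed auto

text \<open>For \<open>n = 0\<close> the last summand vanishes, so the truncated \<open>n - 1\<close> is harmless.\<close>

lemma orth_poly_Suc:
  "orth_poly \<alpha> \<beta> \<gamma> 0 (Suc n) = [:- (\<alpha> + of_nat n * \<gamma>), 1:] * orth_poly \<alpha> \<beta> \<gamma> 0 n
    - smult (of_nat n * \<beta>) (orth_poly \<alpha> \<beta> \<gamma> 0 (n - 1))"
  by (cases n) simp_all

text \<open>Isolates multiplication by the variable, which is the operation that corresponds to
  \<open>T\<close>.\<close>

lemma linear_poly_mult: "[:- c, 1:] * p = [:0, 1:] * p - smult c p"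
  for p :: "'a::comm_ring_1 poly"
  by simp

section \<open>Linear maps given by the images of the powers, and their arrays\<close>

definition poly_basis_map :: "(nat \<Rightarrow> 'a::comm_ring_1 poly) \<Rightarrow> 'a poly \<Rightarrow> 'a poly" where
  "poly_basis_map B p = (\<Sum>k\<le>degree p. smult (coeff p k) (B k))"

lemma poly_basis_map_bound:
  "degree p \<le> n \<Longrightarrow> poly_basis_map B p = (\<Sum>k\<le>n. smult (coeff p k) (B k))"
  unfolding poly_basis_map_def by (rule sum.mono_neutral_left) (auto simp: coeff_eq_0)

lemma poly_basis_map_add: "poly_basis_map B (p + q) = poly_basis_map B p + poly_basis_map B q"
proof -
  define n where "n = max (degree p) (degree q)"
  have "degree p \<le> n" "degree q \<le> n" "degree (p + q) \<le> n"
    by (auto simp: n_def degree_add_le)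
  then show ?thesis
    by (simp add: poly_basis_map_bound smult_add_left sum.distrib)
qed

lemma poly_basis_map_smult: "poly_basis_map B (smult c p) = smult c (poly_basis_map B p)"
proof -
  have sum: "smult c (sum f A) = (\<Sum>k\<in>A. smult c (f k))" for f and A :: "nat set"
    by (induction A rule: infinite_finite_induct) (simp_all add: smult_add_right)
  show ?thesis
    \<comment> \<open>Scaling may lower the degree, so both sums run up to
      \<open>degree p\<close>.\<close>
    unfolding poly_basis_map_bound[OF degree_smult_le[of c p]] poly_basis_map_def[of B p]
    by (simp add: sum)
qed

lemma poly_basis_map_diff: "poly_basis_map B (p - q) = poly_basis_map B p - poly_basis_map B q"
  using poly_basis_map_add[of B "p - q" q] by (simp add: algebra_simps)

lemma poly_basis_map_monom: "poly_basis_map B (monom 1 k) = B k"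
proof -
  have "poly_basis_map B (monom 1 k) = (\<Sum>j\<le>k. if j = k then B j else 0)"
    unfolding poly_basis_map_bound[OF degree_monom_le] by (intro sum.cong) auto
  then show ?thesis by simp
qed

lemma poly_linear_eqI:
  fixes F G :: "'a::comm_ring_1 poly \<Rightarrow> 'a poly"
  assumes "\<And>p q. F (p + q) = F p + F q" "\<And>c p. F (smult c p) = smult c (F p)"
    and "\<And>p q. G (p + q) = G p + G q" "\<And>c p. G (smult c p) = smult c (G p)"
    and monom: "\<And>k. F (monom 1 k) = G (monom 1 k)"
  shows "F p = G p"
proof -
  have zero: "F 0 = 0" "G 0 = 0"
    using assms(2)[of 0 0] assms(4)[of 0 0] by simp_all
  have sum: "F (sum f A) = (\<Sum>k\<in>A. F (f k))" "G (sum f A) = (\<Sum>k\<in>A. G (f k))"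
    for f and A :: "nat set"
    by (induction A rule: infinite_finite_induct) (simp_all add: zero assms(1,3))
  have p: "p = (\<Sum>k\<le>degree p. smult (coeff p k) (monom 1 k))"
    by (simp add: smult_monom poly_as_sum_of_monoms)
  have "F p = (\<Sum>k\<le>degree p. F (smult (coeff p k) (monom 1 k)))"
    by (subst p) (rule sum)
  also have "\<dots> = (\<Sum>k\<le>degree p. G (smult (coeff p k) (monom 1 k)))"
    by (simp only: assms(2,4) monom)
  also have "\<dots> = G p"
    by (subst (2) p) (rule sum(2)[symmetric])
  finally show ?thesis .
qed

text \<open>Row \<open>n\<close> of the product lists the coefficients of the image of
  \<open>A n\<close>; the degree bound matches the summation range of
  \<open>lt_mult\<close>.\<close>

lemma poly_basis_map_inverse_lt_mult:
  assumes "\<And>n. degree (A n) \<le> n" and "\<And>n. poly_basis_map B (A n) = monom 1 n"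
  shows "lt_mult (coeff_array A) (coeff_array B) = id_array"
proof (intro ext)
  fix n k
  have "lt_mult (coeff_array A) (coeff_array B) n k = coeff (poly_basis_map B (A n)) k"
    by (simp add: lt_mult_def coeff_array_def poly_basis_map_bound[OF assms(1)] coeff_sum)
  then show "lt_mult (coeff_array A) (coeff_array B) n k = id_array n k"
    by (simp add: assms(2) id_array_def)
qed

lemma lower_triangular_coeff_array:
  "(\<And>n. degree (A n) \<le> n) \<Longrightarrow> lower_triangular (coeff_array A)"
  unfolding lower_triangular_def coeff_array_def by (meson coeff_eq_0 le_less_trans)

section \<open>Intertwining of \<open>T\<close> with multiplication by \<open>z\<close>, and the
  mutually inverse maps\<close>

lemma poly_basis_map_shifted_dowling_mult:
  "poly_basis_map (shifted_dowling m x) ([:0, 1:] * p)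
    = dowling_op m x (poly_basis_map (shifted_dowling m x) p)"
proof (rule poly_linear_eqI[of "\<lambda>p. poly_basis_map (shifted_dowling m x) ([:0, 1:] * p)"])
  fix k
  \<comment> \<open>On \<open>z^k\<close> both sides equal \<open>Q_(k+1)\<close>.\<close>
  have "[:0, 1:] * monom 1 k = (monom 1 (Suc k) :: 'a poly)"
    by (simp add: monom_Suc)
  then show "poly_basis_map (shifted_dowling m x) ([:0, 1:] * monom 1 k)
      = dowling_op m x (poly_basis_map (shifted_dowling m x) (monom 1 k))"
    by (simp only: poly_basis_map_monom shifted_dowling_Suc)
qed (simp_all only: distrib_left mult_smult_right poly_basis_map_add poly_basis_map_smult
    dowling_op_add dowling_op_smult)

text \<open>On \<open>y^k\<close> this is the three-term recurrence solved for
  \<open>z P_k\<close>.\<close>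

lemma poly_basis_map_orth_poly_dowling_op:
  fixes m x :: "'a::field_char_0"
  defines "P \<equiv> orth_poly (1 + x) (m * x) m 0"
  shows "poly_basis_map P (dowling_op m x p) = [:0, 1:] * poly_basis_map P p"
proof (rule poly_linear_eqI[of "\<lambda>p. poly_basis_map P (dowling_op m x p)"])
  fix k
  have "P (Suc k) = [:- (1 + x + of_nat k * m), 1:] * P k - smult (of_nat k * (m * x)) (P (k - 1))"
    unfolding P_def by (rule orth_poly_Suc)
  then have "P (Suc k) = [:0, 1:] * P k - smult (1 + x + of_nat k * m) (P k)
      - smult (of_nat k * (m * x)) (P (k - 1))"
    by (simp only: linear_poly_mult)
  then show "poly_basis_map P (dowling_op m x (monom 1 k)) =
      [:0, 1:] * poly_basis_map P (monom 1 k)"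
    by (simp add: dowling_op_monom poly_basis_map_add poly_basis_map_smult poly_basis_map_monom)
qed (simp_all only: distrib_left mult_smult_right poly_basis_map_add poly_basis_map_smult
    dowling_op_add dowling_op_smult)

lemma poly_basis_map_orth_poly_shifted_dowling:
  "poly_basis_map (orth_poly (1 + x) (m * x) m 0) (shifted_dowling m x n) = monom 1 n"
proof (induction n)
  case 0
  show ?case
    using poly_basis_map_monom[of "orth_poly (1 + x) (m * x) m 0" 0] by (simp add: shifted_dowling_0)
next
  case (Suc n)
  then show ?case
    by (simp add: shifted_dowling_Suc poly_basis_map_orth_poly_dowling_op monom_Suc)
qed

text \<open>The recurrence reaches back two indices, hence the strong induction. Its subtracted
  terms cancel the lower terms of \<open>T y^k\<close>, leaving \<open>y^(k+1)\<close>.\<close>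

lemma poly_basis_map_shifted_dowling_orth_poly:
  fixes m x :: "'a::field_char_0"
  shows "poly_basis_map (shifted_dowling m x) (orth_poly (1 + x) (m * x) m 0 n) = monom 1 n"
proof (induction n rule: less_induct)
  case (less n)
  let ?P = "orth_poly (1 + x) (m * x) m 0" and ?L = "poly_basis_map (shifted_dowling m x)"
  show ?case
  proof (cases n)
    case 0
    then show ?thesis
      using poly_basis_map_monom[of "shifted_dowling m x" 0] by (simp add: shifted_dowling_0)
  next
    case (Suc k)
    have "?P n = [:0, 1:] * ?P k - smult (1 + x + of_nat k * m) (?P k)
        - smult (of_nat k * (m * x)) (?P (k - 1))"
      unfolding Suc orth_poly_Suc[of _ _ _ k] linear_poly_mult ..
    then have "?L (?P n) = dowling_op m x (?L (?P k)) - smult (1 + x + of_nat k * m) (?L (?P k))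
        - smult (of_nat k * (m * x)) (?L (?P (k - 1)))"
      by (simp only: poly_basis_map_diff poly_basis_map_smult poly_basis_map_shifted_dowling_mult)
    \<comment> \<open>For \<open>k = 0\<close> the truncated \<open>k - 1\<close> is 0, still below
      \<open>n\<close>.\<close>
    moreover have "?L (?P k) = monom 1 k" "?L (?P (k - 1)) = monom 1 (k - 1)"
      using less Suc by simp_all
    ultimately show ?thesis
      by (simp add: dowling_op_monom Suc)
  qed
qed

theorem proposition3:
  fixes m x :: "'a::field_char_0"
  shows "\<exists>\<alpha> \<beta> \<gamma> \<delta> :: 'a.
    moments_of (orth_poly \<alpha> \<beta> \<gamma> \<delta>) (\<lambda>n. poly (dowling_poly m n) x)"
proof -
  let ?P = "orth_poly (1 + x) (m * x) m 0" and ?Q = "shifted_dowling m x"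
  \<comment> \<open>The two composites of the maps give the two matrix products.\<close>
  have "lt_inverse (coeff_array ?P) (coeff_array ?Q)"
    unfolding lt_inverse_def
    by (intro conjI lower_triangular_coeff_array poly_basis_map_inverse_lt_mult
        degree_orth_poly_le degree_shifted_dowling_le
        poly_basis_map_orth_poly_shifted_dowling poly_basis_map_shifted_dowling_orth_poly)
  moreover have "poly (dowling_poly m n) x = coeff_array ?Q n 0" for n
    by (simp add: coeff_array_def coeff_shifted_dowling_0)
  ultimately have "moments_of ?P (\<lambda>n. poly (dowling_poly m n) x)"
    unfolding moments_of_def by blast
  then show ?thesis by blast
qed

end
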